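(* Let $G=(V,E)$ be a graph with $V=[n]$ and $|E|=m$. For any $A\subset[n]$, let $\phi(A)$ be the number of edges in the subgraph $G|_A$ of $G$ induced by $A$. Then any $s=(s_1,\ldots,s_n)\in\mathbb{Z}^n$ is the score sequence of a tournament on $G$ if and only if $\sum_{i=1}^n s_i=m$ and $\sum_{i\in A}s_i\ge\phi(A)$ for all $A\subset[n]$.
   Context: Here $[n]=\{1,\ldots,n\}$. Graphs are finite, undirected and simple (no loops or multiple edges). A tournament on $G=(V,E)$ is an orientation of the edges in $E$, each edge being directed towards the winner of the match between its endpoints; its score sequence $s=(s_1,\ldots,s_n)$ lists the number of wins of each vertex, i.e. $s_i$ is the number of edges directed towards $i$. *)

theory Defs
  imports Main
begin

definition simple_graph :: "'a set \<Rightarrow> 'a set set \<Rightarrow> bool" where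
  "simple_graph V E \<longleftrightarrow> finite V \<and> (\<forall>e\<in>E. e \<subseteq> V \<and> card e = 2)"

definition induced_edges :: "'a set set \<Rightarrow> 'a set \<Rightarrow> 'a set set" where
  "induced_edges E A = {e \<in> E. e \<subseteq> A}"

text \<open>A pair \<open>(u, v)\<close> stands for the edge \<open>{u, v}\<close> directed towards \<open>v\<close>, the winner.\<close>

definition tournament_on :: "'a set set \<Rightarrow> ('a \<times> 'a) set \<Rightarrow> bool" where
  "tournament_on E T \<longleftrightarrow>
     (\<forall>u v. (u, v) \<in> T \<longrightarrow> {u, v} \<in> E) \<and>
     (\<forall>u v. {u, v} \<in> E \<longrightarrow> ((u, v) \<in> T \<longleftrightarrow> (v, u) \<notin> T))"

definition score :: "('a \<times> 'a) set \<Rightarrow> 'a \<Rightarrow> nat" where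
  "score T i = card {a \<in> T. snd a = i}"

text \<open>A vector indexed by \<open>V\<close> is a function of which only the values on \<open>V\<close> matter.\<close>

definition score_sequence_of :: "'a set \<Rightarrow> ('a \<times> 'a) set \<Rightarrow> ('a \<Rightarrow> int) \<Rightarrow> bool" where
  "score_sequence_of V T s \<longleftrightarrow> (\<forall>i\<in>V. s i = int (score T i))"

end

theory Submission
  imports Defs
begin

text \<open>
  Necessity is a count: an edge inside \<open>A\<close> is won by a vertex of \<open>A\<close>, so \<open>A\<close> collects at least as
  many wins as it has edges, and all wins together number \<open>card E\<close>.

  Sufficiency is by induction on the number of edges. Remove an edge \<open>{u, v}\<close> and decide
  who wins it. Awarding it to \<open>v\<close> lowers the demand \<open>s v\<close> by one, and this violates the inequality
  only at a set that contains \<open>v\<close>, misses \<open>u\<close> and is tight (its inequality is an equality);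
  symmetrically for \<open>u\<close>. If both choices failed there would be tight sets \<open>A \<ni> u\<close> and \<open>B \<ni> v\<close>
  separating the two endpoints. But the number of induced edges is supermodular, and the edge
  \<open>{u, v}\<close> lies in \<open>A \<union> B\<close> and in neither of \<open>A\<close> and \<open>B\<close>, so the supermodular inequality for \<open>A\<close>
  and \<open>B\<close> is strict. As sums of \<open>s\<close> are modular, \<open>A \<union> B\<close> or \<open>A \<inter> B\<close> would then violate its
  inequality. Hence one of the two choices is always admissible.
\<close>

section \<open>Counting the wins in a tournament\<close>

lemma simple_graph_finite_edges:
  assumes "simple_graph V E"
  shows "finite E"
  using assms by (auto simp: simple_graph_def intro: finite_subset[of E "Pow V"])

lemma tournament_on_subset:
  assumes "simple_graph V E" "tournament_on E T"
  shows "T \<subseteq> V \<times> V"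
proof (rule subrelI)
  fix u v assume "(u, v) \<in> T"
  then have "{u, v} \<in> E"
    using assms(2) by (simp add: tournament_on_def)
  then have "{u, v} \<subseteq> V"
    using assms(1) by (auto simp: simple_graph_def)
  then show "(u, v) \<in> V \<times> V"
    by simp
qed

lemma tournament_on_finite:
  assumes "simple_graph V E" "tournament_on E T"
  shows "finite T"
  using tournament_on_subset[OF assms] assms(1)
  by (auto simp: simple_graph_def intro: finite_subset)

lemma tournament_on_bij_betw:
  assumes "simple_graph V E" "tournament_on E T"
  shows "bij_betw (\<lambda>(u, v). {u, v}) T E"
  unfolding bij_betw_def
proof
  show "inj_on (\<lambda>(u, v). {u, v}) T"
    using assms(2) by (auto simp: inj_on_def tournament_on_def doubleton_eq_iff)
  show "(\<lambda>(u, v). {u, v}) ` T = E"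
  proof
    show "(\<lambda>(u, v). {u, v}) ` T \<subseteq> E"
      using assms(2) by (auto simp: tournament_on_def)
    show "E \<subseteq> (\<lambda>(u, v). {u, v}) ` T"
    proof
      fix e assume e: "e \<in> E"
      then obtain u v where uv: "e = {u, v}"
        using assms(1) by (auto simp: simple_graph_def card_2_iff)
      then have "(u, v) \<in> T \<or> (v, u) \<in> T"
        using e assms(2) by (auto simp: tournament_on_def)
      then show "e \<in> (\<lambda>(u, v). {u, v}) ` T"
        using uv by (force simp: insert_commute)
    qed
  qed
qed

lemma sum_score:
  assumes "finite T" "finite A"
  shows "(\<Sum>i\<in>A. score T i) = card {a \<in> T. snd a \<in> A}"
proof -
  have "{a \<in> T. snd a \<in> A} = (\<Union>i\<in>A. {a \<in> T. snd a = i})"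
    by auto
  then show ?thesis
    using assms by (simp add: score_def card_UN_disjoint disjoint_iff)
qed

lemma sum_score_all:
  assumes "simple_graph V E" "tournament_on E T"
  shows "(\<Sum>i\<in>V. score T i) = card E"
proof -
  have "{a \<in> T. snd a \<in> V} = T"
    using tournament_on_subset[OF assms] by auto
  then show ?thesis
    using sum_score[OF tournament_on_finite[OF assms], of V] assms(1)
      bij_betw_same_card[OF tournament_on_bij_betw[OF assms]]
    by (simp add: simple_graph_def)
qed

lemma sum_score_ge_induced_edges:
  assumes "simple_graph V E" "tournament_on E T" "A \<subseteq> V"
  shows "card (induced_edges E A) \<le> (\<Sum>i\<in>A. score T i)"
proof -
  have fin: "finite T" "finite A"
    using tournament_on_finite assms by (auto simp: simple_graph_def intro: finite_subset)
  have "induced_edges E A \<subseteq> (\<lambda>(u, v). {u, v}) ` {a \<in> T. snd a \<in> A}"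
    using bij_betw_imp_surj_on[OF tournament_on_bij_betw[OF assms(1,2)]]
    by (force simp: induced_edges_def)
  then show ?thesis
    using fin by (auto simp: sum_score intro: surj_card_le)
qed

section \<open>Induced edges are strictly supermodular across an edge\<close>

text \<open>Supermodularity of the number of induced edges, made strict by an edge that runs between
  \<open>A - B\<close> and \<open>B - A\<close>.\<close>

lemma card_induced_edges_supermodular_strict:
  assumes "finite E" "{u, v} \<in> E" "u \<in> A" "v \<notin> A" "v \<in> B" "u \<notin> B"
  shows "card (induced_edges E A) + card (induced_edges E B)
       < card (induced_edges E (A \<union> B)) + card (induced_edges E (A \<inter> B))"
proof -
  have fin: "finite (induced_edges E X)" for X
    using assms(1) by (simp add: induced_edges_def)
  have "{u, v} \<in> induced_edges E (A \<union> B)" "{u, v} \<notin> induced_edges E A \<union> induced_edges E B"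
    using assms(2-) by (auto simp: induced_edges_def)
  moreover have "induced_edges E A \<union> induced_edges E B \<subseteq> induced_edges E (A \<union> B)"
    by (auto simp: induced_edges_def)
  ultimately have "induced_edges E A \<union> induced_edges E B \<subset> induced_edges E (A \<union> B)"
    by blast
  then have "card (induced_edges E A \<union> induced_edges E B) < card (induced_edges E (A \<union> B))"
    using fin by (intro psubset_card_mono)
  moreover have "induced_edges E A \<inter> induced_edges E B = induced_edges E (A \<inter> B)"
    by (auto simp: induced_edges_def)
  ultimately show ?thesis
    using card_Un_Int[OF fin fin, of A B] by simp
qed

section \<open>Adding one edge\<close>

lemma tournament_on_insert:
  assumes "tournament_on E T" "{u, v} \<notin> E" "u \<noteq> v"
  shows "tournament_on (insert {u, v} E) (insert (u, v) T)"
proof -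
  have new: "(u, v) \<notin> T" "(v, u) \<notin> T"
    using assms(1,2) unfolding tournament_on_def by (blast, metis insert_commute)
  have edge: "{x, y} = {u, v} \<longleftrightarrow> (x, y) = (u, v) \<or> (x, y) = (v, u)" for x y
    by (simp add: doubleton_eq_iff)
  show ?thesis
    unfolding tournament_on_def insert_iff edge using assms(1,3) new
    unfolding tournament_on_def by blast
qed

lemma score_insert:
  assumes "finite T" "(u, v) \<notin> T"
  shows "score (insert (u, v) T) i = score T i + (if i = v then 1 else 0)"
proof (cases "i = v")
  case True
  then have "{a \<in> insert (u, v) T. snd a = i} = insert (u, v) {a \<in> T. snd a = i}"
    by auto
  then show ?thesis
    using True assms by (simp add: score_def)
next
  case False
  then have "{a \<in> insert (u, v) T. snd a = i} = {a \<in> T. snd a = i}"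
    by auto
  then show ?thesis
    using False by (simp add: score_def)
qed

lemma card_induced_edges_insert:
  assumes "finite E" "{u, v} \<notin> E"
  shows "card (induced_edges (insert {u, v} E) A)
       = card (induced_edges E A) + (if u \<in> A \<and> v \<in> A then 1 else 0)"
proof (cases "u \<in> A \<and> v \<in> A")
  case True
  then have "induced_edges (insert {u, v} E) A = insert {u, v} (induced_edges E A)"
    by (auto simp: induced_edges_def)
  then show ?thesis
    using True assms by (simp add: induced_edges_def)
next
  case False
  then have "induced_edges (insert {u, v} E) A = induced_edges E A"
    by (auto simp: induced_edges_def)
  then show ?thesis
    using False by simp
qed

lemma sum_fun_upd_decrement:
  fixes s :: "'a \<Rightarrow> int"
  assumes "finite A"
  shows "(\<Sum>i\<in>A. (s(v := s v - 1)) i) = (\<Sum>i\<in>A. s i) - (if v \<in> A then 1 else 0)"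
proof -
  have "(\<Sum>i\<in>A. (s(v := s v - 1)) i) = (\<Sum>i\<in>A. s i - (if i = v then 1 else 0))"
    by (intro sum.cong) auto
  then show ?thesis
    using assms by (simp add: sum_subtractf)
qed

section \<open>Choosing the winner of an edge\<close>

text \<open>The two hypotheses of sufficiency are bundled so that the induction can pass them from a
  graph to the graph without one edge.\<close>

definition landau_condition :: "'a set \<Rightarrow> 'a set set \<Rightarrow> ('a \<Rightarrow> int) \<Rightarrow> bool" where
  "landau_condition V E s \<longleftrightarrow> (\<Sum>i\<in>V. s i) = int (card E) \<and>
     (\<forall>A\<subseteq>V. int (card (induced_edges E A)) \<le> (\<Sum>i\<in>A. s i))"

text \<open>Awarding \<open>{u, v}\<close> to \<open>v\<close> lowers both sides of the inequality at a set containing both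
  endpoints and changes neither side at a set without \<open>v\<close>. What can break is the inequality at a
  set that contains \<open>v\<close> alone, and integrality makes such a set tight.\<close>

lemma landau_condition_award:
  assumes "finite V" "finite E" "{u, v} \<notin> E" "v \<in> V"
    and "landau_condition V (insert {u, v} E) s"
    and "\<not> landau_condition V E (s(v := s v - 1))"
  obtains B where "B \<subseteq> V" "v \<in> B" "u \<notin> B"
    "(\<Sum>i\<in>B. s i) = int (card (induced_edges (insert {u, v} E) B))"
proof -
  let ?s = "s(v := s v - 1)"
  have "(\<Sum>i\<in>V. ?s i) = int (card E)"
    using assms(1-5) sum_fun_upd_decrement[of V s v] by (simp add: landau_condition_def)
  with assms(6) obtain B where B: "B \<subseteq> V" "(\<Sum>i\<in>B. ?s i) < int (card (induced_edges E B))"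
    by (auto simp: landau_condition_def not_le)
  moreover have "finite B"
    using B(1) assms(1) by (rule finite_subset)
  moreover have "int (card (induced_edges (insert {u, v} E) B)) \<le> (\<Sum>i\<in>B. s i)"
    using assms(5) B(1) by (simp add: landau_condition_def)
  ultimately show ?thesis
    using that[of B] sum_fun_upd_decrement[of B s v]
      card_induced_edges_insert[OF assms(2,3), of B]
    by (auto split: if_splits)
qed

lemma landau_condition_some_award:
  assumes "finite V" "finite E" "{u, v} \<notin> E" "u \<in> V" "v \<in> V"
    and landau: "landau_condition V (insert {u, v} E) s"
  shows "landau_condition V E (s(u := s u - 1)) \<or> landau_condition V E (s(v := s v - 1))"
proof (rule ccontr)
  let ?E = "insert {u, v} E"
  assume contra: "\<not> ?thesis"
  obtain A where A: "A \<subseteq> V" "u \<in> A" "v \<notin> A" "(\<Sum>i\<in>A. s i) = int (card (induced_edges ?E A))"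
    using landau_condition_award[of V E v u s] assms contra by (auto simp: insert_commute)
  obtain B where B: "B \<subseteq> V" "v \<in> B" "u \<notin> B" "(\<Sum>i\<in>B. s i) = int (card (induced_edges ?E B))"
    using landau_condition_award[of V E u v s] assms contra by auto
  have fin: "finite A" "finite B"
    using A(1) B(1) assms(1) by (auto intro: finite_subset)
  have "A \<union> B \<subseteq> V" "A \<inter> B \<subseteq> V"
    using A(1) B(1) by auto
  then have "int (card (induced_edges ?E (A \<union> B))) \<le> (\<Sum>i\<in>A \<union> B. s i)"
    and "int (card (induced_edges ?E (A \<inter> B))) \<le> (\<Sum>i\<in>A \<inter> B. s i)"
    using landau unfolding landau_condition_def by blast+
  moreover have "(\<Sum>i\<in>A \<union> B. s i) + (\<Sum>i\<in>A \<inter> B. s i) = (\<Sum>i\<in>A. s i) + (\<Sum>i\<in>B. s i)"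
    using sum.union_inter[OF fin, of s] .
  moreover have "card (induced_edges ?E A) + card (induced_edges ?E B)
      < card (induced_edges ?E (A \<union> B)) + card (induced_edges ?E (A \<inter> B))"
    using A B assms(2) by (intro card_induced_edges_supermodular_strict) auto
  ultimately show False
    using A(4) B(4) by linarith
qed

section \<open>Construction of the tournament\<close>

lemma landau_condition_empty:
  assumes "finite V" "landau_condition V {} s" "i \<in> V"
  shows "s i = 0"
proof -
  have "0 \<le> s j" if "j \<in> V" for j
    using assms(2) that unfolding landau_condition_def induced_edges_def
    by (auto dest: spec[of _ "{j}"])
  then show ?thesis
    using assms sum_nonneg_eq_0_iff[of V s] by (simp add: landau_condition_def)
qed

lemma tournament_extend:
  assumes "simple_graph V E" "{u, v} \<notin> E" "u \<noteq> v"
    and "tournament_on E T" "score_sequence_of V T (s(v := s v - 1))"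
  shows "tournament_on (insert {u, v} E) (insert (u, v) T)"
    and "score_sequence_of V (insert (u, v) T) s"
proof -
  show "tournament_on (insert {u, v} E) (insert (u, v) T)"
    using assms(4,2,3) by (rule tournament_on_insert)
  have "(u, v) \<notin> T"
    using assms(2,4) by (auto simp: tournament_on_def)
  then have score: "score (insert (u, v) T) i = score T i + (if i = v then 1 else 0)" for i
    using tournament_on_finite[OF assms(1,4)] by (intro score_insert)
  show "score_sequence_of V (insert (u, v) T) s"
    unfolding score_sequence_of_def
  proof
    fix i assume "i \<in> V"
    then have "(s(v := s v - 1)) i = int (score T i)"
      using assms(5) by (simp add: score_sequence_of_def)
    then show "s i = int (score (insert (u, v) T) i)"
      unfolding score by (cases "i = v") simp_all
  qed
qed

lemma landau_condition_imp_tournament: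
  assumes "simple_graph V E" "landau_condition V E s"
  shows "\<exists>T. tournament_on E T \<and> score_sequence_of V T s"
  using simple_graph_finite_edges[OF assms(1)] assms
proof (induction E arbitrary: s rule: finite_induct)
  case empty
  then have "tournament_on {} {}" "score_sequence_of V {} s"
    using landau_condition_empty[of V s]
    by (auto simp: tournament_on_def score_sequence_of_def score_def simple_graph_def)
  then show ?case
    by blast
next
  case (insert e E)
  have graph: "simple_graph V E" and V: "finite V"
    using insert.prems(1) by (auto simp: simple_graph_def)
  obtain u v where e: "e = {u, v}" "u \<noteq> v" and uv: "u \<in> V" "v \<in> V"
    using insert.prems(1) by (auto simp: simple_graph_def card_2_iff)
  have new: "{u, v} \<notin> E" "{v, u} \<notin> E"
    using insert.hyps(2) e(1) by (auto simp: insert_commute)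
  have "landau_condition V E (s(u := s u - 1)) \<or> landau_condition V E (s(v := s v - 1))"
    using landau_condition_some_award[OF V insert.hyps(1) new(1) uv] insert.prems(2) e(1) by simp
  then show ?case
  proof
    assume "landau_condition V E (s(u := s u - 1))"
    from insert.IH[OF graph this] obtain T
      where "tournament_on E T" "score_sequence_of V T (s(u := s u - 1))"
      by blast
    from tournament_extend[OF graph new(2) e(2)[symmetric] this] show ?case
      unfolding e(1) by (metis insert_commute)
  next
    assume "landau_condition V E (s(v := s v - 1))"
    from insert.IH[OF graph this] obtain T
      where "tournament_on E T" "score_sequence_of V T (s(v := s v - 1))"
      by blast
    from tournament_extend[OF graph new(1) e(2) this] show ?case
      unfolding e(1) by blast
  qed
qed

section \<open>The characterisation of score sequences\<close>

lemma tournament_imp_landau_condition: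
  assumes "simple_graph V E" "tournament_on E T" "score_sequence_of V T s"
  shows "landau_condition V E s"
proof -
  have sums: "(\<Sum>i\<in>A. s i) = int (\<Sum>i\<in>A. score T i)" if "A \<subseteq> V" for A
    using assms(3) that by (auto simp: score_sequence_of_def intro: sum.cong)
  show ?thesis
    unfolding landau_condition_def
  proof (intro conjI allI impI)
    show "(\<Sum>i\<in>V. s i) = int (card E)"
      using sums[of V] sum_score_all[OF assms(1,2)] by simp
    show "int (card (induced_edges E A)) \<le> (\<Sum>i\<in>A. s i)" if "A \<subseteq> V" for A
      unfolding sums[OF that] using sum_score_ge_induced_edges[OF assms(1,2) that] by (rule of_nat_mono)
  qed
qed

theorem corollary6:
  fixes n m :: nat and E :: "nat set set" and \<phi> :: "nat set \<Rightarrow> nat" and s :: "nat \<Rightarrow> int"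
  assumes "simple_graph {1..n} E"
    and "card E = m"
    and "\<And>A. A \<subseteq> {1..n} \<Longrightarrow> \<phi> A = card (induced_edges E A)"
  shows "(\<exists>T. tournament_on E T \<and> score_sequence_of {1..n} T s) \<longleftrightarrow>
         (\<Sum>i=1..n. s i) = int m \<and> (\<forall>A\<subseteq>{1..n}. (\<Sum>i\<in>A. s i) \<ge> int (\<phi> A))"
proof -
  have "landau_condition {1..n} E s \<longleftrightarrow>
      (\<Sum>i=1..n. s i) = int m \<and> (\<forall>A\<subseteq>{1..n}. (\<Sum>i\<in>A. s i) \<ge> int (\<phi> A))"
    using assms(2,3) by (simp add: landau_condition_def)
  then show ?thesis
    using landau_condition_imp_tournament[OF assms(1)]
      tournament_imp_landau_condition[OF assms(1)]
    by blast
qed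

end
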